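(* Let $G_0,G_1\in\mathbb{Z}$ with $\gcd(G_0,G_1)=1$, and let $(G_n)_{n\ge0}$ satisfy $G_n=G_{n-1}+G_{n-2}$ for $n\ge 2$. Then for all $k\ge 1$, $$\mathcal{G}_{G_0,G_1}(k)=\operatorname{lcm}\{m \mid \pi_{G_0,G_1}(m)\text{ divides }k\}.$$
   Context: For a positive integer $k$, $\mathcal{G}_{G_0,G_1}(k)$ is the greatest common divisor of all the integers $\sum_{i=0}^{k-1}G_{n+i}$, $n\ge 1$. For an integer $m\ge 2$, the generalized Pisano period $\pi_{G_0,G_1}(m)$ is the smallest positive integer $r$ such that $G_r\equiv G_0 \pmod m$ and $G_{r+1}\equiv G_1\pmod m$ (the sequence modulo $m$ is periodic, so this exists). In the set $\{m \mid \pi_{G_0,G_1}(m)\text{ divides }k\}$, $m$ ranges over integers $m\ge 2$ (together with $m=1$, or equivalently with the convention that the lcm of the empty set is $1$). *)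

theory Defs
  imports "HOL-Number_Theory.Number_Theory"
begin

fun gibonacci :: "int \<Rightarrow> int \<Rightarrow> nat \<Rightarrow> int" where
  "gibonacci G0 G1 0 = G0"
| "gibonacci G0 G1 (Suc 0) = G1"
| "gibonacci G0 G1 (Suc (Suc n)) = gibonacci G0 G1 (Suc n) + gibonacci G0 G1 n"

definition gibonacci_sum_gcd :: "int \<Rightarrow> int \<Rightarrow> nat \<Rightarrow> int" where
  "gibonacci_sum_gcd G0 G1 k = Gcd {(\<Sum>i = 0..<k. gibonacci G0 G1 (n + i)) | n. n \<ge> 1}"

(* Meaningful for m \<ge> 2: the sequence is then purely periodic modulo m
   (the recurrence can be run backwards), so such an r exists. *)
definition pisano_period :: "int \<Rightarrow> int \<Rightarrow> int \<Rightarrow> nat" where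
  "pisano_period G0 G1 m =
     (LEAST r. r > 0 \<and> [gibonacci G0 G1 r = G0] (mod m) \<and> [gibonacci G0 G1 (r + 1) = G1] (mod m))"

end

theory Submission
  imports Defs
begin

text \<open>
  The sum of k consecutive terms telescopes to a difference of two terms k apart, and the
  sequence of these differences satisfies the Fibonacci recurrence.  As the recurrence can be run
  in both directions, m divides all of them iff it divides the first two, i.e. iff k is a
  period modulo m, i.e. iff the least period modulo m divides k.  So the set on the right
  consists of the divisors m > 1 of the gcd on the left.
\<close>

definition is_period :: "int \<Rightarrow> int \<Rightarrow> int \<Rightarrow> nat \<Rightarrow> bool" where
  "is_period G0 G1 m r \<longleftrightarrow> (\<forall>n. m dvd gibonacci G0 G1 (n + r) - gibonacci G0 G1 n)"

lemma dvd_fibonacci_recurrence_iff: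
  fixes D :: "nat \<Rightarrow> int"
  assumes rec: "\<And>n. D (Suc (Suc n)) = D (Suc n) + D n"
  shows "(\<forall>n. m dvd D n) \<longleftrightarrow> m dvd D j \<and> m dvd D (Suc j)"
proof
  assume "m dvd D j \<and> m dvd D (Suc j)"
  then have "m dvd D 0 \<and> m dvd D (Suc 0)"
  proof (induction j)
    case (Suc j)
    then show ?case
      using rec[of j] by (metis dvd_add_right_iff)
  qed
  then have "m dvd D n \<and> m dvd D (Suc n)" for n
    by (induction n) (auto simp: rec)
  then show "\<forall>n. m dvd D n"
    by blast
qed auto

text \<open>The position \<open>j\<close> is left free: 0 matches \<open>pisano_period\<close>, a
  collision index serves the pigeonhole argument, and 2 fits the telescoped sums.\<close>

lemma is_period_iff:
  "is_period G0 G1 m r \<longleftrightarrow>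
     m dvd gibonacci G0 G1 (j + r) - gibonacci G0 G1 j \<and>
     m dvd gibonacci G0 G1 (Suc j + r) - gibonacci G0 G1 (Suc j)"
  unfolding is_period_def by (rule dvd_fibonacci_recurrence_iff) simp

lemma pisano_period_eq_Least:
  "pisano_period G0 G1 m = (LEAST r. r > 0 \<and> is_period G0 G1 m r)"
  unfolding pisano_period_def
  by (simp add: is_period_iff[where j = 0] cong_iff_dvd_diff)

text \<open>Pigeonhole: only finitely many pairs of consecutive residues exist modulo
  \<open>m\<close>, so some pair recurs, and the distance between its two occurrences is a
  period.\<close>

lemma ex_is_period:
  assumes "m > 0"
  shows "\<exists>r>0. is_period G0 G1 m r"
proof -
  let ?G = "gibonacci G0 G1"
  define f where "f n = (?G n mod m, ?G (Suc n) mod m)" for n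
  have "range f \<subseteq> {0..<m} \<times> {0..<m}"
    using assms by (auto simp: f_def)
  then have "finite (range f)"
    by (rule finite_subset) auto
  then have "\<not> inj f"
    using finite_imageD by blast
  then obtain i j where "f j = f i" "i < j"
    unfolding inj_def by (metis linorder_neqE_nat)
  then have "is_period G0 G1 m (j - i)"
    unfolding is_period_iff[where j = i] by (auto simp: f_def mod_eq_dvd_iff)
  with \<open>i < j\<close> show ?thesis
    by (intro exI[of _ "j - i"]) simp
qed

text \<open>Shifting by the period \<open>a\<close> does not change the residue at position
  \<open>n + b\<close>.\<close>

lemma is_period_add_iff:
  assumes "is_period G0 G1 m a"
  shows "is_period G0 G1 m (a + b) \<longleftrightarrow> is_period G0 G1 m b"
proof -
  have "m dvd gibonacci G0 G1 (n + (a + b)) - gibonacci G0 G1 n \<longleftrightarrow>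
        m dvd gibonacci G0 G1 (n + b) - gibonacci G0 G1 n" for n
  proof -
    have "m dvd gibonacci G0 G1 (n + b + a) - gibonacci G0 G1 (n + b)"
      using assms by (simp add: is_period_def)
    from dvd_add_right_iff[OF this, of "gibonacci G0 G1 (n + b) - gibonacci G0 G1 n"]
    show ?thesis
      by (simp add: ac_simps)
  qed
  then show ?thesis
    by (simp add: is_period_def)
qed

lemma is_period_mult_add_iff:
  assumes "is_period G0 G1 m a"
  shows "is_period G0 G1 m (q * a + b) \<longleftrightarrow> is_period G0 G1 m b"
  by (induction q) (simp_all add: is_period_add_iff[OF assms] add.assoc)

lemma pisano_period_dvd_iff:
  assumes "m > 0"
  shows "pisano_period G0 G1 m dvd k \<longleftrightarrow> is_period G0 G1 m k"
proof -
  let ?p = "pisano_period G0 G1 m"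
  have p: "?p > 0" "is_period G0 G1 m ?p"
    using LeastI_ex[OF ex_is_period[OF assms, of G0 G1]] unfolding pisano_period_eq_Least by auto
  have "is_period G0 G1 m k \<longleftrightarrow> is_period G0 G1 m (k mod ?p)"
    using is_period_mult_add_iff[OF p(2), of "k div ?p" "k mod ?p"] by simp
  also have "\<dots> \<longleftrightarrow> k mod ?p = 0"
  proof
    \<comment> \<open>A positive remainder would be a period below the least one.\<close>
    assume "is_period G0 G1 m (k mod ?p)"
    moreover have "k mod ?p < ?p"
      using p(1) by simp
    ultimately show "k mod ?p = 0"
      using not_less_Least[of "k mod ?p" "\<lambda>r. r > 0 \<and> is_period G0 G1 m r"]
      unfolding pisano_period_eq_Least[symmetric] by auto
  qed (simp add: is_period_def)
  finally show ?thesis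
    by (simp add: dvd_eq_mod_eq_0)
qed

text \<open>Each term is the difference of the next two, hence the shift to
  \<open>Suc n\<close>.\<close>

lemma sum_gibonacci:
  "(\<Sum>i = 0..<k. gibonacci G0 G1 (n + i)) = gibonacci G0 G1 (Suc n + k) - gibonacci G0 G1 (Suc n)"
  by (induction k) simp_all

lemma dvd_gibonacci_sum_gcd_iff:
  "m dvd gibonacci_sum_gcd G0 G1 k \<longleftrightarrow> is_period G0 G1 m k"
proof -
  have "m dvd gibonacci_sum_gcd G0 G1 k \<longleftrightarrow>
        (\<forall>n\<ge>1. m dvd gibonacci G0 G1 (Suc n + k) - gibonacci G0 G1 (Suc n))"
    unfolding gibonacci_sum_gcd_def dvd_Gcd_iff sum_gibonacci by blast
  also have "\<dots> \<longleftrightarrow> is_period G0 G1 m k"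
  proof
    assume "\<forall>n\<ge>1. m dvd gibonacci G0 G1 (Suc n + k) - gibonacci G0 G1 (Suc n)"
    \<comment> \<open>The sums start at \<open>n = 1\<close>, so the first two differences sit at
      positions 2 and 3.\<close>
    from this[rule_format, of 1] this[rule_format, of 2]
    show "is_period G0 G1 m k"
      unfolding is_period_iff[where j = 2] by (simp add: numeral_2_eq_2)
  qed (simp only: is_period_def, blast)
  finally show ?thesis .
qed

text \<open>For \<open>g \<ge> 2\<close> the set contains \<open>g\<close> itself; for
  \<open>g = 1\<close> it is empty, with \<open>Lcm\<close> 1; for \<open>g = 0\<close> it is
  infinite, with \<open>Lcm\<close> 0.\<close>

lemma Lcm_nontrivial_divisors_int:
  fixes g :: int
  assumes "g \<ge> 0"
  shows "Lcm {m. m \<ge> 2 \<and> m dvd g} = g"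
proof -
  let ?L = "Lcm {m. m \<ge> 2 \<and> m dvd g}"
  have dvd_L: "m dvd ?L" if "m \<ge> 2" "m dvd g" for m
    using that by (intro dvd_Lcm) auto
  have "g dvd ?L"
  proof -
    consider "g = 0" | "g = 1" | "g \<ge> 2"
      using assms by linarith
    then show ?thesis
    proof cases
      case 1
      \<comment> \<open>Every integer from 2 on divides 0; this one exceeds
        \<open>\<bar>?L\<bar>\<close>, so it can divide \<open>?L\<close> only if
        \<open>?L = 0\<close>.\<close>
      then have "\<bar>?L\<bar> + 2 dvd ?L"
        by (intro dvd_L) auto
      then have "?L = 0"
        using dvd_imp_le_int[of ?L "\<bar>?L\<bar> + 2"] by force
      then show ?thesis
        by (simp only: dvd_0_right)
    qed (use dvd_L[of g] in auto)
  qed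
  moreover have "?L dvd g"
    by (rule Lcm_least) auto
  ultimately show ?thesis
    using assms by (intro zdvd_antisym_nonneg) auto
qed

theorem theorem3p11:
  fixes G0 G1 :: int and k :: nat
  assumes "gcd G0 G1 = 1"
    and "k \<ge> 1"
  shows "gibonacci_sum_gcd G0 G1 k = Lcm {m :: int. m \<ge> 2 \<and> pisano_period G0 G1 m dvd k}"
proof -
  have "{m. m \<ge> 2 \<and> pisano_period G0 G1 m dvd k} = {m. m \<ge> 2 \<and> m dvd gibonacci_sum_gcd G0 G1 k}"
    by (auto simp: pisano_period_dvd_iff dvd_gibonacci_sum_gcd_iff)
  then show ?thesis
    \<comment> \<open>Unfolding the definition exposes a \<open>Gcd\<close>, whose nonnegativity is
      the hypothesis on \<open>g\<close>.\<close>
    by (simp add: Lcm_nontrivial_divisors_int gibonacci_sum_gcd_def)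
qed

end
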